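(* Let $f:R_1\to R_2$ be a surjective ring homomorphism, let $S\subseteq R_1$ be an $m$-system, and let $P$ be an ideal of $R_1$ such that $\ker(f)\subseteq P$. If $P$ is an almost right $S$-prime ideal of $R_1$ associated with $s\in S$, then $f(P)$ is an almost right $f(S)$-prime ideal of $R_2$ associated with $f(s)$.
   Context: Rings are associative, not necessarily commutative, and not necessarily with unity; ideals are two-sided. An $m$-system of a ring $R$ is a nonempty subset $S\subseteq R$ such that for all $a,b\in S$ there is $r\in R$ with $arb\in S$; the image of an $m$-system under a surjective ring homomorphism is an $m$-system. $\langle s\rangle$ denotes the two-sided ideal generated by $s$. For ideals $A,B$, $AB$ is the additive subgroup generated by products $ab$ ($a\in A,b\in B$), and $P^2=PP$. An ideal $P$ of $R$ with $P\cap S=\emptyset$ is an almost right $S$-prime ideal associated with $s\in S$ if for all ideals $A,B$ of $R$ with $AB\subseteq P$ and $AB\not\subseteq P^2$, either $A\langle s\rangle\subseteq P$ or $B\langle s\rangle\subseteq P$. *)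

theory Defs
  imports Complex_Main
begin

text \<open>Rings are types of class \<open>ring\<close>: associative, not necessarily commutative and
  not necessarily with unity; in particular a ring homomorphism has no unit condition.\<close>

definition add_subgroup :: "'a::ring set \<Rightarrow> bool" where
  "add_subgroup H \<longleftrightarrow> 0 \<in> H \<and> (\<forall>a\<in>H. \<forall>b\<in>H. a + b \<in> H) \<and> (\<forall>a\<in>H. - a \<in> H)"

definition two_sided_ideal :: "'a::ring set \<Rightarrow> bool" where
  "two_sided_ideal I \<longleftrightarrow> add_subgroup I \<and> (\<forall>r. \<forall>a\<in>I. r * a \<in> I \<and> a * r \<in> I)"

text \<open>Without unity, \<open>\<langle>s\<rangle>\<close> is not \<open>RsR\<close> in general; the hull contains \<open>s\<close> itself.\<close>

definition principal_ideal :: "'a::ring \<Rightarrow> 'a set" where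
  "principal_ideal s = two_sided_ideal hull {s}"

definition ideal_prod :: "'a::ring set \<Rightarrow> 'a set \<Rightarrow> 'a set" where
  "ideal_prod A B = add_subgroup hull {a * b |a b. a \<in> A \<and> b \<in> B}"

definition m_system :: "'a::ring set \<Rightarrow> bool" where
  "m_system S \<longleftrightarrow> S \<noteq> {} \<and> (\<forall>a\<in>S. \<forall>b\<in>S. \<exists>r. a * r * b \<in> S)"

definition rng_hom :: "('a::ring \<Rightarrow> 'b::ring) \<Rightarrow> bool" where
  "rng_hom f \<longleftrightarrow> (\<forall>x y. f (x + y) = f x + f y) \<and> (\<forall>x y. f (x * y) = f x * f y)"

text \<open>The standing assumptions of the notion (\<open>S\<close> an \<open>m\<close>-system, \<open>P\<close> an ideal disjoint
  from \<open>S\<close>, \<open>s \<in> S\<close>) are part of the predicate.\<close>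

definition almost_right_S_prime :: "'a::ring set \<Rightarrow> 'a set \<Rightarrow> 'a \<Rightarrow> bool" where
  "almost_right_S_prime S P s \<longleftrightarrow>
     m_system S \<and> two_sided_ideal P \<and> P \<inter> S = {} \<and> s \<in> S \<and>
     (\<forall>A B. two_sided_ideal A \<longrightarrow> two_sided_ideal B \<longrightarrow>
        ideal_prod A B \<subseteq> P \<longrightarrow> \<not> ideal_prod A B \<subseteq> ideal_prod P P \<longrightarrow>
        ideal_prod A (principal_ideal s) \<subseteq> P \<or> ideal_prod B (principal_ideal s) \<subseteq> P)"

end

theory Submission
  imports Defs
begin

text \<open>
  The proof pulls ideals of the target back along \<open>f\<close> and pushes the conclusion forward again.
  Forming the product of two ideals commutes with taking images under any homomorphism
  (\<open>image_ideal_prod\<close>), and forming a principal ideal commutes with taking images under a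
  surjective one (\<open>image_principal_ideal\<close>); for the latter surjectivity is what
  makes the image of an ideal an ideal. The hypothesis \<open>ker f \<subseteq> P\<close> says that \<open>P\<close> is saturated:
  \<open>f x \<in> f(P)\<close> already forces \<open>x \<in> P\<close> (\<open>mem_image_iff_if_ker_subset\<close>).

  Let \<open>A\<close> and \<open>B\<close> be ideals of the target with \<open>AB \<subseteq> f(P)\<close> and \<open>AB \<not>\<subseteq> f(P)\<^sup>2\<close>, and let \<open>A'\<close>, \<open>B'\<close> be
  their preimages, so that \<open>f(A'B') = AB\<close>. Saturation gives \<open>A'B' \<subseteq> P\<close>, while \<open>A'B' \<subseteq> P\<^sup>2\<close> would
  give \<open>AB \<subseteq> f(P\<^sup>2) = f(P)\<^sup>2\<close>. Hence \<open>A'\<langle>s\<rangle> \<subseteq> P\<close> or \<open>B'\<langle>s\<rangle> \<subseteq> P\<close>, and applying \<open>f\<close> yields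
  \<open>A\<langle>f(s)\<rangle> \<subseteq> f(P)\<close> or \<open>B\<langle>f(s)\<rangle> \<subseteq> f(P)\<close>. Disjointness of \<open>f(P)\<close> and \<open>f(S)\<close> is saturation once more.
\<close>

lemma rng_hom_add: "rng_hom f \<Longrightarrow> f (x + y) = f x + f y"
  and rng_hom_mult: "rng_hom f \<Longrightarrow> f (x * y) = f x * f y"
  by (auto simp: rng_hom_def)

lemma rng_hom_zero:
  assumes "rng_hom f" shows "f 0 = 0"
  using rng_hom_add[OF assms, of 0 0] by simp

lemma rng_hom_minus:
  assumes "rng_hom f" shows "f (- x) = - f x"
  using rng_hom_add[OF assms, of x "- x"] rng_hom_zero[OF assms]
  by (simp add: eq_neg_iff_add_eq_0 add.commute)

lemma add_subgroup_image:
  assumes "rng_hom f" "add_subgroup H" shows "add_subgroup (f ` H)"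
proof -
  have "0 \<in> f ` H"
    using assms(2) rng_hom_zero[OF assms(1)] by (metis add_subgroup_def image_eqI)
  moreover have "f a + f b \<in> f ` H" if "a \<in> H" "b \<in> H" for a b
    using assms(2) that rng_hom_add[OF assms(1)] by (metis add_subgroup_def image_eqI)
  moreover have "- f a \<in> f ` H" if "a \<in> H" for a
    using assms(2) that rng_hom_minus[OF assms(1)] by (metis add_subgroup_def image_eqI)
  ultimately show ?thesis unfolding add_subgroup_def by blast
qed

lemma add_subgroup_vimage:
  assumes "rng_hom f" "add_subgroup H" shows "add_subgroup (f -` H)"
  using assms unfolding add_subgroup_def
  by (auto simp: rng_hom_add rng_hom_minus rng_hom_zero)

lemma two_sided_ideal_image:
  assumes "rng_hom f" "surj f" "two_sided_ideal I" shows "two_sided_ideal (f ` I)"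
proof -
  have "r * f a \<in> f ` I \<and> f a * r \<in> f ` I" if "a \<in> I" for r a
  proof -
    obtain t where "r = f t" using assms(2) by (meson surjD)
    then show ?thesis
      using assms(3) that rng_hom_mult[OF assms(1)] by (metis two_sided_ideal_def image_eqI)
  qed
  then show ?thesis
    using assms add_subgroup_image by (auto simp: two_sided_ideal_def)
qed

lemma two_sided_ideal_vimage:
  assumes "rng_hom f" "two_sided_ideal I" shows "two_sided_ideal (f -` I)"
  using assms add_subgroup_vimage by (auto simp: two_sided_ideal_def rng_hom_mult)

lemma add_subgroup_hull: "add_subgroup (add_subgroup hull X)"
  by (rule hull_in) (auto simp: add_subgroup_def)

lemma two_sided_ideal_principal_ideal: "two_sided_ideal (principal_ideal s)"
  unfolding principal_ideal_def
  by (rule hull_in) (auto simp: two_sided_ideal_def add_subgroup_def)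

text \<open>
  Each of the next two equalities follows from minimality of the hulls on both sides, since
  the structures in question are stable under both images and preimages.
\<close>

lemma image_add_subgroup_hull:
  assumes "rng_hom f"
  shows "f ` (add_subgroup hull X) = add_subgroup hull (f ` X)"
proof
  have "add_subgroup hull X \<subseteq> f -` (add_subgroup hull (f ` X))"
    by (intro hull_minimal add_subgroup_vimage assms add_subgroup_hull)
       (auto intro: hull_inc)
  then show "f ` (add_subgroup hull X) \<subseteq> add_subgroup hull (f ` X)" by blast
  show "add_subgroup hull (f ` X) \<subseteq> f ` (add_subgroup hull X)"
    by (intro hull_minimal add_subgroup_image assms add_subgroup_hull image_mono hull_subset)
qed

lemma image_principal_ideal:
  assumes "rng_hom f" "surj f"
  shows "f ` principal_ideal s = principal_ideal (f s)"
proof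
  have "principal_ideal s \<subseteq> f -` principal_ideal (f s)"
    unfolding principal_ideal_def[of s]
    by (intro hull_minimal two_sided_ideal_vimage assms two_sided_ideal_principal_ideal)
       (auto simp: principal_ideal_def intro: hull_inc)
  then show "f ` principal_ideal s \<subseteq> principal_ideal (f s)" by blast
  show "principal_ideal (f s) \<subseteq> f ` principal_ideal s"
    unfolding principal_ideal_def[of "f s"]
    by (intro hull_minimal two_sided_ideal_image assms two_sided_ideal_principal_ideal)
       (auto simp: principal_ideal_def intro: hull_inc)
qed

lemma image_ideal_prod:
  assumes "rng_hom f"
  shows "f ` ideal_prod A B = ideal_prod (f ` A) (f ` B)"
proof -
  have "f ` {a * b |a b. a \<in> A \<and> b \<in> B} = {a * b |a b. a \<in> f ` A \<and> b \<in> f ` B}"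
    (is "f ` ?X = ?Y")
  proof
    show "f ` ?X \<subseteq> ?Y" using rng_hom_mult[OF assms] by blast
    have "f a * f b \<in> f ` ?X" if "a \<in> A" "b \<in> B" for a b
      unfolding rng_hom_mult[OF assms, symmetric] using that by blast
    then show "?Y \<subseteq> f ` ?X" by blast
  qed
  then show ?thesis
    unfolding ideal_prod_def by (simp add: image_add_subgroup_hull[OF assms])
qed

lemma m_system_image:
  assumes "rng_hom f" "m_system S" shows "m_system (f ` S)"
proof -
  have "\<exists>r. f a * r * f b \<in> f ` S" if "a \<in> S" "b \<in> S" for a b
  proof -
    have "\<exists>r. a * r * b \<in> S"
      using assms(2) that unfolding m_system_def by simp
    then obtain r where "a * r * b \<in> S" ..
    then have "f a * f r * f b \<in> f ` S"
      unfolding rng_hom_mult[OF assms(1), symmetric] by (rule imageI)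
    then show ?thesis ..
  qed
  then show ?thesis using assms(2) unfolding m_system_def by simp
qed

lemma mem_image_iff_if_ker_subset:
  assumes "rng_hom f" "add_subgroup H" "{x. f x = 0} \<subseteq> H"
  shows "f x \<in> f ` H \<longleftrightarrow> x \<in> H"
proof
  assume "f x \<in> f ` H"
  then obtain p where p: "p \<in> H" "f x = f p" by blast
  have "f (x + - p) = 0"
    using p(2) by (simp only: rng_hom_add[OF assms(1)] rng_hom_minus[OF assms(1)]) simp
  then have "x + - p \<in> H" using assms(3) by blast
  then have "(x + - p) + p \<in> H" using assms(2) p(1) unfolding add_subgroup_def by blast
  then show "x \<in> H" by simp
qed simp

theorem theorem3p17:
  fixes f :: "'a::ring \<Rightarrow> 'b::ring" and S P :: "'a set" and s :: 'a
  assumes "rng_hom f" and "surj f"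
    and "m_system S"
    and "two_sided_ideal P"
    and "{x. f x = 0} \<subseteq> P"
    and "almost_right_S_prime S P s"
  shows "almost_right_S_prime (f ` S) (f ` P) (f s)"
proof -
  have saturated: "f x \<in> f ` P \<longleftrightarrow> x \<in> P" for x
    using assms(1,4,5) by (simp add: mem_image_iff_if_ker_subset two_sided_ideal_def)
  have "ideal_prod A (principal_ideal (f s)) \<subseteq> f ` P \<or> ideal_prod B (principal_ideal (f s)) \<subseteq> f ` P"
    if A: "two_sided_ideal A" and B: "two_sided_ideal B"
      and AB: "ideal_prod A B \<subseteq> f ` P" and not_sq: "\<not> ideal_prod A B \<subseteq> ideal_prod (f ` P) (f ` P)"
    for A B
  proof -
    have image_prod: "f ` ideal_prod (f -` A) C = ideal_prod A (f ` C)" for A C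
      using image_ideal_prod[OF \<open>rng_hom f\<close>] \<open>surj f\<close> by simp
    have image_AB: "f ` ideal_prod (f -` A) (f -` B) = ideal_prod A B"
      using image_prod \<open>surj f\<close> by simp
    have "f x \<in> f ` P" if "x \<in> ideal_prod (f -` A) (f -` B)" for x
      using AB imageI[OF that, of f] unfolding image_AB by (rule subsetD)
    then have "ideal_prod (f -` A) (f -` B) \<subseteq> P"
      unfolding saturated by (rule subsetI)
    moreover have "\<not> ideal_prod (f -` A) (f -` B) \<subseteq> ideal_prod P P"
      using not_sq unfolding image_AB[symmetric] image_ideal_prod[OF \<open>rng_hom f\<close>, of P P, symmetric]
      by (auto dest: image_mono)
    ultimately have "ideal_prod (f -` A) (principal_ideal s) \<subseteq> P \<or>
        ideal_prod (f -` B) (principal_ideal s) \<subseteq> P"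
      using assms(6) two_sided_ideal_vimage[OF \<open>rng_hom f\<close>] A B
      unfolding almost_right_S_prime_def by blast
    then have "f ` ideal_prod (f -` A) (principal_ideal s) \<subseteq> f ` P \<or>
        f ` ideal_prod (f -` B) (principal_ideal s) \<subseteq> f ` P"
      by blast
    then show ?thesis
      unfolding image_prod image_principal_ideal[OF assms(1,2)] .
  qed
  moreover have "f ` P \<inter> f ` S = {}"
  proof -
    have "f x \<notin> f ` P" if "x \<in> S" for x
      unfolding saturated using assms(6) that by (auto simp: almost_right_S_prime_def)
    then show ?thesis by (simp add: disjoint_iff ball_simps image_iff) metis
  qed
  moreover have "f s \<in> f ` S"
    using assms(6) by (simp add: almost_right_S_prime_def)
  ultimately show ?thesis
    unfolding almost_right_S_prime_def
    using m_system_image[OF assms(1,3)] two_sided_ideal_image[OF assms(1,2,4)] by simp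
qed

end
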